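(* Consider the compact Boolean group $2^\omega$ and the $\sigma$-ideals $\mathcal M$, $\mathcal N$, $\mathcal E$ on it. Then $2^\omega$ contains (1) a subgroup $H_1\in\mathcal M\setminus\mathcal N$ if $\mathrm{cof}(\mathcal N)=\mathrm{cov}(\mathcal N)$; (2) a subgroup $H_2\in\mathcal M\setminus\mathcal E$ if $\mathrm{non}(\mathcal M)=\mathrm{cov}(\mathcal N)$; (3) a subgroup $H_3\in(\mathcal M\cap\mathcal N)\setminus\mathcal E$ if $\mathrm{cof}(\mathcal M)=\mathrm{cov}(\mathcal M)=\mathrm{cov}(\mathcal N)$.
   Context: $2^\omega$ is the countable power of the two-element group $\{0,1\}$ with addition modulo $2$, with the product topology. On $2^\omega$: $\mathcal M$ is the $\sigma$-ideal of meager sets, $\mathcal N$ is the $\sigma$-ideal of sets of Haar measure zero, and $\mathcal E$ is the $\sigma$-ideal generated by compact sets of Haar measure zero (i.e. all subsets of countable unions of such compact sets). For an ideal $\mathcal I$ on a set $X$ with $\bigcup\mathcal I=X\notin\mathcal I$: $\mathrm{non}(\mathcal I)=\min\{|A|:A\subset X,\ A\notin\mathcal I\}$; $\mathrm{cov}(\mathcal I)=\min\{|\mathcal A|:\mathcal A\subset\mathcal I,\ \bigcup\mathcal A=X\}$; $\mathrm{cof}(\mathcal I)=\min\{|\mathcal A|:\mathcal A\subset\mathcal I,\ \forall I\in\mathcal I\ \exists A\in\mathcal A\ (I\subset A)\}$. *)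

theory Defs
  imports "HOL-Probability.Probability" "HOL-Algebra.Group"
begin

unbundle cardinal_syntax

text \<open>
  The least cardinality of a member of a nonempty family, as a cardinal order in the sense of
  \<^theory>\<open>HOL.BNF_Cardinal_Order_Relation\<close>; it is unique up to \<open>=o\<close>, and \<open>=o\<close>
  compares cardinals across different types.
\<close>
definition min_card :: "'a set set \<Rightarrow> 'a rel" where
  "min_card F = (SOME r. \<exists>A\<in>F. r = |A| \<and> (\<forall>B\<in>F. |A| \<le>o |B| ))"

lemma min_card_attained:
  assumes "F \<noteq> {}"
  shows "\<exists>A\<in>F. min_card F = |A| \<and> (\<forall>B\<in>F. |A| \<le>o |B| )"
proof -
  have "\<exists>r\<in>card_of ` F. \<forall>r'\<in>card_of ` F. r \<le>o r'"
    using assms by (intro exists_minim_Card_order) (auto simp: card_of_Card_order)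
  then have "\<exists>r. \<exists>A\<in>F. r = |A| \<and> (\<forall>B\<in>F. |A| \<le>o |B| )" by blast
  then show ?thesis unfolding min_card_def by (rule someI_ex)
qed

text \<open>The underlying set of an ideal is always the whole type \<open>'a\<close>.\<close>

definition ideal_non :: "'a set set \<Rightarrow> 'a rel" where
  "ideal_non I = min_card {A. A \<notin> I}"

definition ideal_cov :: "'a set set \<Rightarrow> 'a set rel" where
  "ideal_cov I = min_card {\<A>. \<A> \<subseteq> I \<and> \<Union>\<A> = UNIV}"

definition ideal_cof :: "'a set set \<Rightarrow> 'a set rel" where
  "ideal_cof I = min_card {\<A>. \<A> \<subseteq> I \<and> (\<forall>B\<in>I. \<exists>A\<in>\<A>. B \<subseteq> A)}"

text \<open>
  A point is a function \<open>nat \<Rightarrow> bool\<close>; the library's topology on this type is the product of the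
  discrete topologies. Addition modulo 2 is exclusive or.
\<close>
type_synonym cantor = "nat \<Rightarrow> bool"

definition cantor_group :: "cantor monoid" where
  "cantor_group = \<lparr>carrier = UNIV, mult = (\<lambda>x y n. x n \<noteq> y n), one = (\<lambda>n. False)\<rparr>"

lemma comm_group_cantor_group: "comm_group cantor_group"
  by (rule comm_groupI) (auto simp: cantor_group_def fun_eq_iff)

lemma cantor_group_square: "x \<otimes>\<^bsub>cantor_group\<^esub> x = \<one>\<^bsub>cantor_group\<^esub>"
  by (simp add: cantor_group_def)

lemma compact_UNIV_cantor: "compact (UNIV :: cantor set)"
proof -
  have "compact_space (euclidean :: bool topology)"
    by (simp add: compact_space_def finite_imp_compact)
  then have "compact_space (product_topology (\<lambda>_::nat. euclidean :: bool topology) UNIV)"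
    by (simp add: compact_space_product_topology)
  then show ?thesis by (simp add: euclidean_product_topology compact_space_def)
qed

text \<open>
  Normalised Haar measure is the fair coin-tossing measure; the lemmas below establish the
  characterising properties (a translation-invariant Borel probability measure).
\<close>
definition cantor_measure :: "cantor measure" where
  "cantor_measure = (\<Pi>\<^sub>M n\<in>UNIV. measure_pmf (pmf_of_set (UNIV :: bool set)))"

instance bool :: second_countable_topology
proof
  show "\<exists>B::bool set set. countable B \<and> open = generate_topology B"
  proof (intro exI conjI)
    show "countable (UNIV :: bool set set)" by (simp add: countable_finite)
    show "open = generate_topology (UNIV :: bool set set)"
      by (simp add: fun_eq_iff Topological_Spaces.open_discrete generate_topology.Basis)
  qed
qed

lemma sets_cantor_measure: "sets cantor_measure = sets borel"
proof -
  have "sets (borel :: bool measure) = UNIV"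
    by (auto intro: borel_open Topological_Spaces.open_discrete)
  then have "sets cantor_measure = sets (\<Pi>\<^sub>M n\<in>(UNIV::nat set). (borel :: bool measure))"
    unfolding cantor_measure_def by (intro sets_PiM_cong) auto
  then show ?thesis by (simp add: sets_PiM_equal_borel)
qed

lemma prob_space_cantor_measure: "prob_space cantor_measure"
  unfolding cantor_measure_def by (intro prob_space_PiM measure_pmf.prob_space_axioms)

lemma cantor_measure_translation_invariant:
  "distr cantor_measure cantor_measure (\<lambda>x. a \<otimes>\<^bsub>cantor_group\<^esub> x) = cantor_measure"
proof -
  let ?p = "pmf_of_set (UNIV :: bool set)"
  let ?M = "\<lambda>n::nat. measure_pmf ?p"
  let ?t = "\<lambda>(x::cantor) n. a n \<noteq> x n"
  interpret prob_space "Pi\<^sub>M UNIV ?M"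
    by (intro prob_space_PiM measure_pmf.prob_space_axioms)
  have ps: "\<And>i. prob_space (?M i)" by (intro measure_pmf.prob_space_axioms)
  have coord: "emeasure (?M n) ((\<lambda>b. a n \<noteq> b) -` X) = emeasure (?M n) X" for n X
  proof -
    have "map_pmf (\<lambda>b. a n \<noteq> b) ?p = ?p"
      by (rule map_pmf_of_set_bij_betw[of _ UNIV UNIV]) (auto simp: bij_betw_def inj_on_def image_def UNIV_bool)
    then have "emeasure (measure_pmf (map_pmf (\<lambda>b. a n \<noteq> b) ?p)) X = emeasure (?M n) X" by simp
    then show ?thesis by simp
  qed
  have meas: "?t \<in> measurable (Pi\<^sub>M UNIV ?M) (Pi\<^sub>M UNIV ?M)"
  proof (rule measurable_PiM_single')
    fix i :: nat
    have "(\<lambda>x. x i) \<in> measurable (Pi\<^sub>M UNIV ?M) (?M i)" by (rule measurable_component_singleton) simp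
    then show "(\<lambda>x. ?t x i) \<in> measurable (Pi\<^sub>M UNIV ?M) (?M i)"
      by (rule measurable_compose) simp
  qed simp
  have "Pi\<^sub>M UNIV ?M = distr (Pi\<^sub>M UNIV ?M) (Pi\<^sub>M UNIV ?M) ?t"
  proof (rule measure_eqI_PiM_infinite[OF refl])
    show "finite_measure (Pi\<^sub>M UNIV ?M)" by unfold_locales
    fix A and J :: "nat set"
    assume J: "finite J" "J \<subseteq> UNIV" and "\<And>i. i \<in> J \<Longrightarrow> A i \<in> sets (?M i)"
    let ?A' = "\<lambda>n. (\<lambda>b. a n \<noteq> b) -` A n"
    have "emeasure (Pi\<^sub>M UNIV ?M) (prod_emb UNIV ?M J (Pi\<^sub>E J A)) = (\<Prod>j\<in>J. emeasure (?M j) (A j))"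
      using J by (intro emeasure_PiM_emb ps) auto
    also have "\<dots> = (\<Prod>j\<in>J. emeasure (?M j) (?A' j))" by (simp only: coord)
    also have "\<dots> = emeasure (Pi\<^sub>M UNIV ?M) (prod_emb UNIV ?M J (Pi\<^sub>E J ?A'))"
      using J by (intro emeasure_PiM_emb[symmetric] ps) auto
    also have "prod_emb UNIV ?M J (Pi\<^sub>E J ?A') =
        ?t -` prod_emb UNIV ?M J (Pi\<^sub>E J A) \<inter> space (Pi\<^sub>M UNIV ?M)"
      by (auto simp: prod_emb_def space_PiM PiE_iff)
    also have "emeasure (Pi\<^sub>M UNIV ?M) \<dots> =
        emeasure (distr (Pi\<^sub>M UNIV ?M) (Pi\<^sub>M UNIV ?M) ?t) (prod_emb UNIV ?M J (Pi\<^sub>E J A))"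
      using J by (intro emeasure_distr[symmetric] meas sets_PiM_I) auto
    finally show "emeasure (Pi\<^sub>M UNIV ?M) (prod_emb UNIV ?M J (Pi\<^sub>E J A)) =
        emeasure (distr (Pi\<^sub>M UNIV ?M) (Pi\<^sub>M UNIV ?M) ?t) (prod_emb UNIV ?M J (Pi\<^sub>E J A))" .
  qed simp
  then show ?thesis by (simp add: cantor_measure_def cantor_group_def)
qed

definition nowhere_dense :: "'a::topological_space set \<Rightarrow> bool" where
  "nowhere_dense A \<longleftrightarrow> interior (closure A) = {}"

definition meager_ideal :: "'a::topological_space set set" where
  "meager_ideal = {A. \<exists>\<C>. countable \<C> \<and> (\<forall>C\<in>\<C>. nowhere_dense C) \<and> A = \<Union>\<C>}"

text \<open>Completing the measure makes every subset of a Borel null set a null set.\<close>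
definition null_ideal :: "cantor set set" where
  "null_ideal = null_sets (completion cantor_measure)"

definition compact_null_ideal :: "cantor set set" where
  "compact_null_ideal =
     {A. \<exists>\<C>. countable \<C> \<and> (\<forall>C\<in>\<C>. compact C \<and> C \<in> null_ideal) \<and> A \<subseteq> \<Union>\<C>}"

end

theory Submission
  imports Defs "HOL-Algebra.Free_Abelian_Groups"
begin

text \<open>
  All three subgroups come from one transfinite construction. Fix a set \<open>G\<close> of forbidden points
  that omits the neutral element, and a family \<open>R\<close> of requirements, each asking the subgroup to
  contain a point of a certain kind. Well-order \<open>R\<close> in type \<open>|R|\<close> and choose one point for each
  requirement, so that no translate of the new point by a finite sum of earlier points lies in
  \<open>G\<close>. Fewer than \<open>|R|\<close> translates of \<open>G\<close> have to be avoided at each stage. Since every element of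
  the group has order two, each nonzero element of the generated subgroup is a sum of finitely
  many distinct chosen points; the latest of them shows that it misses \<open>G\<close>
  (\<open>transfinite_subgroup\<close>). If \<open>G\<close> is comeager, the subgroup is meager; if \<open>G\<close> is null and \<open>|R|\<close> is
  the covering number of the null ideal, the translates of \<open>G\<close> can be avoided.
  The set \<open>runs\<close> is comeager, null, and omits the neutral element.

  For the first subgroup, the requirements are to leave each member of a cofinal family of null
  sets.

  For the second one, the requirements have to force the subgroup out of every countable union of
  compact null sets, that is, out of the ideal \<open>E\<close>, and there may be no more of them than
  \<open>non(M)\<close>, the least size of a nonmeager set. Each sequence \<open>z\<close> codes
  a null set \<open>trap z\<close>, the upper limit of clopen sets of measure at most \<open>2\<^sup>-\<^sup>n\<close>. A generic
  \<open>z\<close> codes, infinitely often, a clopen set covering a prescribed compact null set, so the \<open>z\<close>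
  whose trap does not contain that set form a meager set. A nonmeager set of codes therefore
  supplies \<open>non(M)\<close> traps such that every set in the ideal \<open>E\<close> lies in one of them.

  For the third one, split the coordinates into even and odd ones, which identifies the group with its
  square. The subgroup is kept away from a comeager null set in the even half and from a conull
  meager set in the odd half, and is thus both meager and null. To leave \<open>E\<close>, take a
  cofinal family of meager sets. By Fubini, a compact null set has null sections at a dense set
  of points \<open>y\<close> of the odd half, so the pairs \<open>(y, z)\<close> for which \<open>trap z\<close> fails to cover the section
  at \<open>y\<close> form a meager set (\<open>meager_untrapped\<close>). Given a meager set \<open>M\<close> of the family, choose
  \<open>(y, z)\<close> outside \<open>M\<close>, using the covering number of the meager ideal to control \<open>y\<close>, and only
  then choose an even half \<open>x\<close> outside the null set \<open>trap z\<close>. The point \<open>(x, y)\<close> then avoids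
  all sets of \<open>E\<close> whose exceptional pairs lie in \<open>M\<close>.
\<close>

section \<open>Cylinders and the topology of the Cantor group\<close>

abbreviation xor :: "cantor \<Rightarrow> cantor \<Rightarrow> cantor" (infixl "\<oplus>\<^sub>2" 65)
  where "x \<oplus>\<^sub>2 y \<equiv> (\<lambda>n. x n \<noteq> y n)"

abbreviation zero2 :: cantor where "zero2 \<equiv> (\<lambda>_. False)"

definition cyl :: "cantor \<Rightarrow> nat \<Rightarrow> cantor set" where
  "cyl x n = {y. \<forall>i<n. y i = x i}"

lemma self_in_cyl [simp]: "x \<in> cyl x n"
  by (simp add: cyl_def)

lemma cyl_mono: "m \<le> n \<Longrightarrow> cyl x n \<subseteq> cyl x m"
  by (auto simp: cyl_def)

lemma open_coords:
  assumes "finite J"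
  shows "open {x :: cantor. \<forall>i\<in>J. x i = a i}"
  using product_topology_basis'[OF assms, of "\<lambda>i. {a i}" "\<lambda>i. i"]
  by (simp add: Topological_Spaces.open_discrete)

lemma open_cyl: "open (cyl x n)"
  using open_coords[of "{..<n}" x] by (simp add: cyl_def Ball_def)

lemma open_contains_cyl:
  assumes "open U" "x \<in> U"
  shows "\<exists>n. cyl x n \<subseteq> U"
proof -
  have "openin (product_topology (\<lambda>_::nat. euclidean :: bool topology) UNIV) U"
    using assms(1) by (simp add: open_fun_def)
  from product_topology_open_contains_basis[OF this assms(2)] obtain X where
    X: "x \<in> (\<Pi>\<^sub>E i\<in>UNIV. X i)" "finite {i. X i \<noteq> UNIV}" "(\<Pi>\<^sub>E i\<in>UNIV. X i) \<subseteq> U" by auto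
  obtain n where n: "\<And>i. X i \<noteq> UNIV \<Longrightarrow> i < n"
    using X(2) by (metis (mono_tags, lifting) finite_nat_set_iff_bounded mem_Collect_eq)
  have "y \<in> (\<Pi>\<^sub>E i\<in>UNIV. X i)" if "y \<in> cyl x n" for y
  proof -
    have "y i \<in> X i" for i
      using that X(1) n[of i] by (cases "X i = UNIV") (auto simp: cyl_def PiE_iff)
    then show ?thesis by (simp add: PiE_iff)
  qed
  with X(3) show ?thesis by blast
qed

lemma open_iff_cyl: "open U \<longleftrightarrow> (\<forall>x\<in>U. \<exists>n. cyl x n \<subseteq> U)" for U :: "cantor set"
proof
  assume *: "\<forall>x\<in>U. \<exists>n. cyl x n \<subseteq> U"
  show "open U"
  proof (subst open_subopen, intro ballI)
    fix x assume "x \<in> U"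
    with * obtain n where "cyl x n \<subseteq> U" by blast
    then show "\<exists>T. open T \<and> x \<in> T \<and> T \<subseteq> U"
      using open_cyl[of x n] by (intro exI[of _ "cyl x n"]) (auto simp: cyl_def)
  qed
qed (blast intro: open_contains_cyl)

lemma continuous_coords:
  fixes f :: "cantor \<Rightarrow> cantor"
  assumes "\<And>n. \<exists>m. \<forall>x y. (\<forall>i<m. x i = y i) \<longrightarrow> f x n = f y n"
  shows "continuous_on UNIV f"
proof -
  have "\<exists>m. \<forall>n<k. \<forall>x y. (\<forall>i<m. x i = y i) \<longrightarrow> f x n = f y n" for k :: nat
  proof (induction k)
    case (Suc k)
    then obtain m1 where m1: "\<forall>n<k. \<forall>x y. (\<forall>i<m1. x i = y i) \<longrightarrow> f x n = f y n" by blast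
    obtain m2 where m2: "\<forall>x y. (\<forall>i<m2. x i = y i) \<longrightarrow> f x k = f y k" using assms by blast
    show ?case
      by (rule exI[of _ "max m1 m2"]) (use m1 m2 in \<open>auto simp: less_Suc_eq\<close>)
  qed simp
  then have *: "\<exists>m. \<forall>n<k. \<forall>x y. (\<forall>i<m. x i = y i) \<longrightarrow> f x n = f y n" for k by blast
  have "open (f -` U)" if "open U" for U
    unfolding open_iff_cyl
  proof
    fix x assume "x \<in> f -` U"
    then obtain k where k: "cyl (f x) k \<subseteq> U" using open_contains_cyl[OF \<open>open U\<close>] by blast
    obtain m where m: "\<forall>n<k. \<forall>x y. (\<forall>i<m. x i = y i) \<longrightarrow> f x n = f y n" using * by blast
    have "f y \<in> cyl (f x) k" if "y \<in> cyl x m" for y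
      using that m unfolding cyl_def by blast
    with k show "\<exists>n. cyl x n \<subseteq> f -` U" by blast
  qed
  then show ?thesis by (simp add: continuous_on_open_vimage)
qed

lemma Hausdorff_cantor: "Hausdorff_space (euclidean :: cantor topology)"
proof -
  have "\<exists>U V. open U \<and> open V \<and> x \<in> U \<and> y \<in> V \<and> disjnt U V" if "x \<noteq> y" for x y :: bool
    using that separation_t2[of x y] unfolding disjnt_def by blast
  then have "Hausdorff_space (euclidean :: bool topology)" by (simp add: Hausdorff_space_def)
  then have "Hausdorff_space (product_topology (\<lambda>_::nat. euclidean :: bool topology) UNIV)"
    by (simp add: Hausdorff_space_product_topology)
  then show ?thesis by (simp add: euclidean_product_topology)
qed

lemma compact_imp_closed_cantor: "closed K" if "compact K" for K :: "cantor set"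
  using compactin_imp_closedin[OF Hausdorff_cantor, of K] that by simp

section \<open>Splitting a sequence into its even and odd coordinates\<close>

definition ev :: "cantor \<Rightarrow> cantor" where "ev p = (\<lambda>n. p (2 * n))"

definition od :: "cantor \<Rightarrow> cantor" where "od p = (\<lambda>n. p (Suc (2 * n)))"

definition join :: "cantor \<Rightarrow> cantor \<Rightarrow> cantor" where
  "join x y = (\<lambda>n. if even n then x (n div 2) else y (n div 2))"

lemma ev_join [simp]: "ev (join x y) = x" and od_join [simp]: "od (join x y) = y"
  and join_ev_od [simp]: "join (ev p) (od p) = p"
  by (auto simp: ev_def od_def join_def fun_eq_iff)

lemma ev_xor: "ev (x \<oplus>\<^sub>2 y) = ev x \<oplus>\<^sub>2 ev y" and od_xor: "od (x \<oplus>\<^sub>2 y) = od x \<oplus>\<^sub>2 od y"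
  by (simp_all add: ev_def od_def)

lemma join_cyl: "y \<in> cyl (ev p) n \<Longrightarrow> z \<in> cyl (od p) n \<Longrightarrow> join y z \<in> cyl p n"
  by (auto simp: cyl_def join_def ev_def od_def)

lemma ev_cyl: "p \<in> cyl q (2 * n) \<Longrightarrow> ev p \<in> cyl (ev q) n"
  and od_cyl: "p \<in> cyl q (2 * n) \<Longrightarrow> od p \<in> cyl (od q) n"
  by (auto simp: cyl_def ev_def od_def)

lemma continuous_join_left: "continuous_on UNIV (\<lambda>x. join x y)"
proof (rule continuous_coords)
  fix n
  have "n div 2 < Suc n" by simp
  then show "\<exists>m. \<forall>x x'. (\<forall>i<m. x i = x' i) \<longrightarrow> join x y n = join x' y n"
    unfolding join_def by metis
qed

lemma continuous_ev: "continuous_on UNIV ev"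
  by (rule continuous_coords) (auto simp: ev_def)

lemma continuous_od: "continuous_on UNIV od"
  by (rule continuous_coords) (auto simp: od_def)

section \<open>Meager sets\<close>

text \<open>
  Cylinders form a base, so nowhere density becomes a statement about extending finite
  sequences; all density arguments below take this form.
\<close>
lemma nowhere_dense_cyl:
  fixes A :: "cantor set"
  shows "nowhere_dense A \<longleftrightarrow> (\<forall>x n. \<exists>y m. y \<in> cyl x n \<and> cyl y m \<inter> A = {})"
proof
  assume nd: "nowhere_dense A"
  show "\<forall>x n. \<exists>y m. y \<in> cyl x n \<and> cyl y m \<inter> A = {}"
  proof (intro allI)
    fix x n
    have "\<not> cyl x n \<subseteq> closure A"
    proof
      assume "cyl x n \<subseteq> closure A"
      then have "cyl x n \<subseteq> interior (closure A)" using open_cyl by (rule interior_maximal)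
      then show False using nd by (auto simp: nowhere_dense_def cyl_def)
    qed
    then obtain y where y: "y \<in> cyl x n" "y \<in> - closure A" by blast
    obtain m where "cyl y m \<subseteq> - closure A" using open_contains_cyl[OF _ y(2)] by blast
    then have "cyl y m \<inter> A = {}" using closure_subset by blast
    with y(1) show "\<exists>y m. y \<in> cyl x n \<and> cyl y m \<inter> A = {}" by blast
  qed
next
  assume *: "\<forall>x n. \<exists>y m. y \<in> cyl x n \<and> cyl y m \<inter> A = {}"
  show "nowhere_dense A"
    unfolding nowhere_dense_def
  proof (rule ccontr)
    assume "interior (closure A) \<noteq> {}"
    then obtain x where "x \<in> interior (closure A)" by blast
    then obtain n where n: "cyl x n \<subseteq> interior (closure A)"
      using open_contains_cyl[OF open_interior] by blast
    obtain y m where y: "y \<in> cyl x n" "cyl y m \<inter> A = {}" using * by blast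
    have "y \<in> closure A" using y(1) n interior_subset by blast
    moreover have "y \<in> cyl y m" by (simp add: cyl_def)
    moreover have "closure A \<subseteq> - cyl y m"
      using y(2) open_cyl[of y m] by (intro closure_minimal) (auto simp: closed_def)
    ultimately show False by blast
  qed
qed

lemma nowhere_dense_subset: "nowhere_dense A \<Longrightarrow> B \<subseteq> A \<Longrightarrow> nowhere_dense B"
  unfolding nowhere_dense_def by (metis closure_mono interior_mono subset_empty)

lemma nowhere_dense_imp_meager: "nowhere_dense A \<Longrightarrow> A \<in> meager_ideal"
  unfolding meager_ideal_def by (intro CollectI exI[of _ "{A}"]) auto

lemma nowhere_dense_singleton: "nowhere_dense {x :: cantor}"
  unfolding nowhere_dense_cyl
proof (intro allI)
  fix w n
  define y where "y = (\<lambda>i. if i < n then w i else \<not> x i)"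
  have "y \<in> cyl w n" by (simp add: cyl_def y_def)
  moreover have "cyl y (Suc n) \<inter> {x} = {}" by (auto simp: cyl_def y_def)
  ultimately show "\<exists>y m. y \<in> cyl w n \<and> cyl y m \<inter> {x} = {}" by blast
qed

lemma Union_meager_ideal: "\<Union>(meager_ideal :: cantor set set) = UNIV"
  using nowhere_dense_imp_meager[OF nowhere_dense_singleton] by blast

lemma meager_UN:
  assumes "countable I" "\<And>i. i \<in> I \<Longrightarrow> A i \<in> meager_ideal"
  shows "(\<Union>i\<in>I. A i) \<in> meager_ideal"
proof -
  have "\<forall>i\<in>I. \<exists>\<C>. countable \<C> \<and> (\<forall>C\<in>\<C>. nowhere_dense C) \<and> A i = \<Union>\<C>"
    using assms(2) by (auto simp: meager_ideal_def)
  then obtain \<C> where "\<forall>i\<in>I. countable (\<C> i) \<and> (\<forall>C\<in>\<C> i. nowhere_dense C) \<and> A i = \<Union>(\<C> i)"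
    by metis
  then show ?thesis
    unfolding meager_ideal_def using assms(1)
    by (intro CollectI exI[of _ "\<Union>i\<in>I. \<C> i"]) auto
qed

lemma meager_subset:
  assumes "A \<in> meager_ideal" "B \<subseteq> A"
  shows "B \<in> meager_ideal"
proof -
  obtain \<C> where C: "countable \<C>" "\<forall>C\<in>\<C>. nowhere_dense C" "A = \<Union>\<C>"
    using assms(1) by (auto simp: meager_ideal_def)
  have "(\<Union>C\<in>\<C>. C \<inter> B) \<in> meager_ideal"
    using C by (intro meager_UN nowhere_dense_imp_meager) (auto intro: nowhere_dense_subset)
  moreover have "(\<Union>C\<in>\<C>. C \<inter> B) = B" using C(3) assms(2) by auto
  ultimately show ?thesis by simp
qed

text \<open>
  This is the Baire category theorem for the compact Hausdorff space of sequences.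
\<close>
lemma UNIV_not_meager: "(UNIV :: cantor set) \<notin> meager_ideal"
proof
  assume "(UNIV :: cantor set) \<in> meager_ideal"
  then obtain \<C> :: "cantor set set" where C: "countable \<C>" "\<forall>C\<in>\<C>. nowhere_dense C" "UNIV = \<Union>\<C>"
    unfolding meager_ideal_def by blast
  have "compact_space (euclidean :: cantor topology)"
    using compact_UNIV_cantor by (simp add: compact_space_def)
  moreover note Hausdorff_cantor
  ultimately have "locally_compact_space (euclidean :: cantor topology) \<and> regular_space (euclidean :: cantor topology)"
    by (simp add: compact_imp_locally_compact_space compact_Hausdorff_or_regular_imp_normal_space
        compact_Hausdorff_imp_regular_space)
  then have "euclidean interior_of \<Union>(closure ` \<C>) = {}"
    using C(1,2) by (intro Baire_category_alt) (auto simp: nowhere_dense_def)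
  moreover have "\<Union>(closure ` \<C>) = UNIV" using C(3) closure_subset by blast
  ultimately show False by simp
qed

lemma meager_vimage:
  fixes f :: "cantor \<Rightarrow> cantor"
  assumes f: "\<And>A. nowhere_dense A \<Longrightarrow> nowhere_dense (f -` A)" and "A \<in> meager_ideal"
  shows "f -` A \<in> meager_ideal"
proof -
  obtain \<C> where C: "countable \<C>" "\<forall>C\<in>\<C>. nowhere_dense C" "A = \<Union>\<C>"
    using assms(2) by (auto simp: meager_ideal_def)
  have "(\<Union>C\<in>\<C>. f -` C) \<in> meager_ideal"
    using C by (intro meager_UN nowhere_dense_imp_meager f) auto
  then show ?thesis using C(3) by (simp add: vimage_Union)
qed

text \<open>
  The half that is not constrained can be left unchanged when a cylinder is shrunk.
\<close>
lemma nowhere_dense_vimage_ev: "nowhere_dense A \<Longrightarrow> nowhere_dense (ev -` A)"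
  unfolding nowhere_dense_cyl
proof (intro allI)
  fix p n
  assume "\<forall>x n. \<exists>y m. y \<in> cyl x n \<and> cyl y m \<inter> A = {}"
  then obtain y m where y: "y \<in> cyl (ev p) n" "cyl y m \<inter> A = {}" by blast
  have "cyl (join y (od p)) (2 * m) \<inter> ev -` A = {}"
    using y(2) by (auto dest!: ev_cyl)
  then show "\<exists>y m. y \<in> cyl p n \<and> cyl y m \<inter> ev -` A = {}"
    using join_cyl[OF y(1) self_in_cyl] by blast
qed

lemma nowhere_dense_vimage_xor: "nowhere_dense A \<Longrightarrow> nowhere_dense ((\<lambda>x. h \<oplus>\<^sub>2 x) -` A)"
  unfolding nowhere_dense_cyl
proof (intro allI)
  fix p n
  assume "\<forall>x n. \<exists>y m. y \<in> cyl x n \<and> cyl y m \<inter> A = {}"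
  then obtain y m where y: "y \<in> cyl (h \<oplus>\<^sub>2 p) n" "cyl y m \<inter> A = {}" by blast
  have "h \<oplus>\<^sub>2 y \<in> cyl p n" using y(1) by (auto simp: cyl_def)
  moreover have "h \<oplus>\<^sub>2 q \<in> cyl y m" if "q \<in> cyl (h \<oplus>\<^sub>2 y) m" for q
    using that by (auto simp: cyl_def)
  then have "cyl (h \<oplus>\<^sub>2 y) m \<inter> (\<lambda>x. h \<oplus>\<^sub>2 x) -` A = {}" using y(2) by auto
  ultimately show "\<exists>y m. y \<in> cyl p n \<and> cyl y m \<inter> (\<lambda>x. h \<oplus>\<^sub>2 x) -` A = {}" by blast
qed

lemma meager_vimage_ev: "A \<in> meager_ideal \<Longrightarrow> ev -` A \<in> meager_ideal"
  using meager_vimage nowhere_dense_vimage_ev by blast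

lemma meager_vimage_xor: "A \<in> meager_ideal \<Longrightarrow> (\<lambda>x. h \<oplus>\<^sub>2 x) -` A \<in> meager_ideal"
  using meager_vimage nowhere_dense_vimage_xor by blast

section \<open>The coin-tossing measure\<close>

lemma space_cantor_measure [simp]: "space cantor_measure = UNIV"
  by (simp add: cantor_measure_def space_PiM)

abbreviation coin :: "bool measure" where "coin \<equiv> measure_pmf (pmf_of_set UNIV)"

lemma emeasure_coin: "emeasure coin {b} = ennreal (1/2)"
  by (simp add: emeasure_pmf_single UNIV_bool)

lemma prod_emb_box: "prod_emb UNIV (\<lambda>_. coin) J (Pi\<^sub>E J A) = {x :: cantor. \<forall>i\<in>J. x i \<in> A i}"
  by (auto simp: prod_emb_def PiE_iff)

lemma emeasure_box:
  assumes "finite J"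
  shows "emeasure cantor_measure {x. \<forall>i\<in>J. x i \<in> A i} = (\<Prod>i\<in>J. emeasure coin (A i))"
proof -
  have ps: "\<And>i. prob_space coin" by (intro measure_pmf.prob_space_axioms)
  have "emeasure (Pi\<^sub>M UNIV (\<lambda>_. coin)) (prod_emb UNIV (\<lambda>_. coin) J (Pi\<^sub>E J A)) = (\<Prod>i\<in>J. emeasure coin (A i))"
    using assms by (intro emeasure_PiM_emb ps) auto
  then show ?thesis by (simp only: prod_emb_box cantor_measure_def)
qed

lemma emeasure_coords:
  assumes "finite J"
  shows "emeasure cantor_measure {x. \<forall>i\<in>J. x i = a i} = ennreal ((1/2) ^ card J)"
  using emeasure_box[OF assms, of "\<lambda>i. {a i}"]
  by (subst ennreal_power[symmetric]) (simp_all add: emeasure_coin)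

lemma emeasure_cyl: "emeasure cantor_measure (cyl x n) = ennreal ((1/2) ^ n)"
  using emeasure_coords[of "{..<n}" x] by (simp add: cyl_def Ball_def)

lemma open_measurable: "open U \<Longrightarrow> U \<in> sets cantor_measure"
  by (simp add: sets_cantor_measure)

lemma measurable_coord: "(\<lambda>x. x i) \<in> cantor_measure \<rightarrow>\<^sub>M count_space UNIV"
proof -
  have "(\<lambda>x. x i) \<in> cantor_measure \<rightarrow>\<^sub>M coin"
    unfolding cantor_measure_def by (rule measurable_component_singleton) simp
  then show ?thesis by (simp add: measurable_def)
qed

lemma measurable_into_cantor:
  assumes "\<And>i. (\<lambda>x. f x i) \<in> N \<rightarrow>\<^sub>M count_space UNIV"
  shows "f \<in> N \<rightarrow>\<^sub>M cantor_measure"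
  unfolding cantor_measure_def
proof (rule measurable_PiM_single')
  show "(\<lambda>x. f x i) \<in> N \<rightarrow>\<^sub>M coin" for i using assms[of i] by (simp add: measurable_def)
qed auto

lemma measurable_ev: "ev \<in> cantor_measure \<rightarrow>\<^sub>M cantor_measure"
  and measurable_od: "od \<in> cantor_measure \<rightarrow>\<^sub>M cantor_measure"
  by (rule measurable_into_cantor, simp add: ev_def od_def measurable_coord)+

lemma measurable_join:
  "(\<lambda>p. join (snd p) (fst p)) \<in> cantor_measure \<Otimes>\<^sub>M cantor_measure \<rightarrow>\<^sub>M cantor_measure"
  proof (rule measurable_into_cantor)
    fix i
    show "(\<lambda>x. join (snd x) (fst x) i) \<in> (cantor_measure \<Otimes>\<^sub>M cantor_measure) \<rightarrow>\<^sub>M count_space UNIV"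
      unfolding join_def
      by (cases "even i") (auto intro: measurable_compose[OF measurable_snd measurable_coord]
          measurable_compose[OF measurable_fst measurable_coord])
  qed

text \<open>
  Interleaving two independent coin-tossing sequences yields a coin-tossing sequence. It suffices
  to compare the measures of the sets that constrain finitely many coordinates. The odd half
  comes first in the pair so that Fubini's theorem, applied to this map, yields sections at a
  fixed odd half.
\<close>
lemma distr_join:
  "distr (cantor_measure \<Otimes>\<^sub>M cantor_measure) cantor_measure (\<lambda>p. join (snd p) (fst p)) = cantor_measure"
  (is "distr ?P _ ?j = _")
proof -
  interpret C: prob_space cantor_measure by (rule prob_space_cantor_measure)
  interpret P: pair_prob_space cantor_measure cantor_measure ..
  have meas: "?j \<in> ?P \<rightarrow>\<^sub>M cantor_measure" by (rule measurable_join)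
  have "cantor_measure = distr ?P cantor_measure ?j"
  proof (rule measure_eqI_PiM_infinite[of _ UNIV "\<lambda>_. coin"])
    fix A :: "nat \<Rightarrow> bool set" and J :: "nat set"
    assume J: "finite J"
    define J0 J1 where "J0 = {i. 2 * i \<in> J}" and "J1 = {i. Suc (2 * i) \<in> J}"
    have im: "(*) 2 ` J0 \<union> (\<lambda>i. Suc (2 * i)) ` J1 = J"
    proof
      show "J \<subseteq> (*) 2 ` J0 \<union> (\<lambda>i. Suc (2 * i)) ` J1"
      proof
        fix n assume "n \<in> J"
        then show "n \<in> (*) 2 ` J0 \<union> (\<lambda>i. Suc (2 * i)) ` J1"
          by (cases "even n") (auto simp: J0_def J1_def elim!: evenE oddE)
      qed
    qed (auto simp: J0_def J1_def)
    have fin: "finite J0" "finite J1"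
      using finite_vimageI[OF J, of "(*) 2"] finite_vimageI[OF J, of "\<lambda>i. Suc (2 * i)"]
      by (simp_all add: J0_def J1_def vimage_def inj_on_def)
    let ?B = "{x. \<forall>i\<in>J. x i \<in> A i}"
    let ?X = "{x :: cantor. \<forall>i\<in>J0. x i \<in> A (2 * i)}" and ?Y = "{x :: cantor. \<forall>i\<in>J1. x i \<in> A (Suc (2 * i))}"
    have box: "{x :: cantor. \<forall>i\<in>K. x i \<in> D i} \<in> sets cantor_measure" if "finite K" for K D
    proof -
      have "prod_emb UNIV (\<lambda>_. coin) K (Pi\<^sub>E K D) \<in> sets (Pi\<^sub>M UNIV (\<lambda>_. coin))"
        using that by (intro sets_PiM_I) auto
      then show ?thesis by (simp only: prod_emb_box cantor_measure_def)
    qed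
    have "emeasure (distr ?P cantor_measure ?j) ?B = emeasure ?P (?j -` ?B \<inter> space ?P)"
      by (rule emeasure_distr[OF meas box[OF J]])
    also have "?j -` ?B \<inter> space ?P = ?Y \<times> ?X"
    proof -
      have "(\<forall>i\<in>J. join x y i \<in> A i) \<longleftrightarrow>
          (\<forall>i\<in>J0. x i \<in> A (2 * i)) \<and> (\<forall>i\<in>J1. y i \<in> A (Suc (2 * i)))" for x y
        by (subst im[symmetric]) (simp add: ball_Un join_def)
      then show ?thesis by (auto simp: space_pair_measure)
    qed
    also have "emeasure ?P \<dots> = emeasure cantor_measure ?Y * emeasure cantor_measure ?X"
      by (intro C.emeasure_pair_measure_Times box fin)
    also have "\<dots> = (\<Prod>i\<in>J1. emeasure coin (A (Suc (2 * i)))) * (\<Prod>i\<in>J0. emeasure coin (A (2 * i)))"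
      by (simp only: emeasure_box fin)
    also have "\<dots> = (\<Prod>i\<in>(\<lambda>i. Suc (2 * i)) ` J1. emeasure coin (A i)) * (\<Prod>i\<in>(*) 2 ` J0. emeasure coin (A i))"
      by (simp add: prod.reindex inj_on_def)
    also have "\<dots> = (\<Prod>i\<in>(*) 2 ` J0 \<union> (\<lambda>i. Suc (2 * i)) ` J1. emeasure coin (A i))"
      using fin by (subst prod.union_disjoint) (auto simp: mult.commute, presburger)
    also have "\<dots> = emeasure cantor_measure ?B"
      unfolding im by (simp only: emeasure_box J)
    finally show "emeasure cantor_measure (prod_emb UNIV (\<lambda>_. coin) J (Pi\<^sub>E J A)) =
       emeasure (distr ?P cantor_measure ?j) (prod_emb UNIV (\<lambda>_. coin) J (Pi\<^sub>E J A))"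
      unfolding prod_emb_box by simp
  qed (simp_all add: cantor_measure_def C.finite_measure_axioms[unfolded cantor_measure_def])
  then show ?thesis by simp
qed

lemma distr_ev: "distr cantor_measure cantor_measure ev = cantor_measure"
  and distr_od: "distr cantor_measure cantor_measure od = cantor_measure"
proof -
  interpret C: prob_space cantor_measure by (rule prob_space_cantor_measure)
  interpret P: pair_prob_space cantor_measure cantor_measure ..
  have d: "distr cantor_measure cantor_measure f =
      distr (cantor_measure \<Otimes>\<^sub>M cantor_measure) cantor_measure (\<lambda>p. f (join (snd p) (fst p)))"
    if "f \<in> cantor_measure \<rightarrow>\<^sub>M cantor_measure" for f
    using distr_distr[OF that measurable_join] by (simp add: distr_join o_def)
  show "distr cantor_measure cantor_measure od = cantor_measure"
    unfolding d[OF measurable_od]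
    using C.distr_pair_fst[of cantor_measure] by simp
  show "distr cantor_measure cantor_measure ev = cantor_measure"
    unfolding d[OF measurable_ev]
  proof (rule measure_eqI, goal_cases)
    case (2 A)
    then have A: "A \<in> sets cantor_measure" by simp
    have "snd -` A \<inter> space (cantor_measure \<Otimes>\<^sub>M cantor_measure) = UNIV \<times> A"
      by (auto simp: space_pair_measure)
    moreover have "emeasure (cantor_measure \<Otimes>\<^sub>M cantor_measure) (UNIV \<times> A) = emeasure cantor_measure A"
      using C.emeasure_pair_measure_Times[of UNIV cantor_measure A] A C.emeasure_space_1
      by (simp add: sets_cantor_measure)
    ultimately show ?case using A by (simp add: emeasure_distr)
  qed simp
qed

section \<open>Null sets\<close>

lemma null_ideal_iff: "A \<in> null_ideal \<longleftrightarrow> (\<exists>N\<in>null_sets cantor_measure. A \<subseteq> N)"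
  unfolding null_ideal_def by (rule null_sets_completion_iff2)

lemma null_idealI_AE: "AE x in cantor_measure. x \<notin> A \<Longrightarrow> A \<in> null_ideal"
  by (auto simp: eventually_ae_filter null_ideal_iff)

lemma null_subset: "A \<in> null_ideal \<Longrightarrow> B \<subseteq> A \<Longrightarrow> B \<in> null_ideal"
  unfolding null_ideal_iff by blast

lemma countable_Union_null:
  assumes "countable \<C>" "\<And>C. C \<in> \<C> \<Longrightarrow> C \<in> null_ideal"
  shows "\<Union>\<C> \<in> null_ideal"
  using null_sets_UN'[OF assms(1), of "\<lambda>C. C"] assms(2) by (simp add: null_ideal_def)

lemma UNIV_not_null: "UNIV \<notin> null_ideal"
proof -
  interpret prob_space cantor_measure by (rule prob_space_cantor_measure)
  show ?thesis using emeasure_space_1 by (auto simp: null_ideal_iff null_sets_def top.extremum_unique)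
qed

text \<open>
  The Borel--Cantelli lemma, with the measures dominated by a geometric series.
\<close>
lemma limsup_null:
  assumes "\<And>n. A n \<in> sets cantor_measure" "\<And>n. emeasure cantor_measure (A n) \<le> ennreal ((1/2) ^ n)"
  shows "{x. \<forall>m. \<exists>n\<ge>m. x \<in> A n} \<in> null_ideal"
proof (rule null_idealI_AE)
  interpret C: prob_space cantor_measure by (rule prob_space_cantor_measure)
  have "measure cantor_measure (A n) \<le> (1/2) ^ n" for n
    using assms(2)[of n] by (simp add: C.emeasure_eq_measure)
  then have "summable (\<lambda>n. measure cantor_measure (A n))"
    by (intro summable_comparison_test'[OF summable_geometric[of "1/2 :: real"], of 0]) auto
  then have "AE x in cantor_measure. eventually (\<lambda>n. x \<in> space cantor_measure - A n) sequentially"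
    using assms(1) by (intro borel_cantelli_AE1) (auto simp: C.emeasure_eq_measure)
  then show "AE x in cantor_measure. x \<notin> {x. \<forall>m. \<exists>n\<ge>m. x \<in> A n}"
    by (rule AE_mp) (auto simp: eventually_sequentially)
qed

lemma null_singleton: "{x} \<in> null_ideal"
proof (rule null_subset[OF limsup_null[of "cyl x"]])
  show "cyl x n \<in> sets cantor_measure" for n by (rule open_measurable[OF open_cyl])
  show "emeasure cantor_measure (cyl x n) \<le> ennreal ((1/2) ^ n)" for n by (simp only: emeasure_cyl order_refl)
qed auto

lemma Union_null_ideal: "\<Union>null_ideal = UNIV"
  using null_singleton by blast

lemma null_vimage:
  assumes f: "f \<in> cantor_measure \<rightarrow>\<^sub>M cantor_measure" "distr cantor_measure cantor_measure f = cantor_measure"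
    and A: "A \<in> null_ideal"
  shows "f -` A \<in> null_ideal"
proof -
  obtain N where N: "N \<in> null_sets cantor_measure" "A \<subseteq> N" using A by (auto simp: null_ideal_iff)
  have "f -` N \<inter> space cantor_measure \<in> null_sets cantor_measure"
    using N(1) f null_sets_distr_iff[OF f(1), of N] by simp
  then show ?thesis using N(2) unfolding null_ideal_iff by (intro bexI[of _ "f -` N"]) auto
qed

lemma null_vimage_xor: "A \<in> null_ideal \<Longrightarrow> (\<lambda>x. h \<oplus>\<^sub>2 x) -` A \<in> null_ideal"
proof (rule null_vimage)
  show "(\<lambda>x. h \<oplus>\<^sub>2 x) \<in> cantor_measure \<rightarrow>\<^sub>M cantor_measure"
    by (rule measurable_into_cantor) (rule measurable_compose[OF measurable_coord], simp)
  show "distr cantor_measure cantor_measure (\<lambda>x. h \<oplus>\<^sub>2 x) = cantor_measure"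
    using cantor_measure_translation_invariant[of h] by (simp add: cantor_group_def)
qed

lemmas null_vimage_ev = null_vimage[OF measurable_ev distr_ev]

lemmas null_vimage_od = null_vimage[OF measurable_od distr_od]

text \<open>
  Fubini's theorem, transported along the measure-preserving interleaving map.
\<close>
lemma null_sections:
  assumes "K \<in> null_ideal"
  shows "AE y in cantor_measure. {x. join x y \<in> K} \<in> null_ideal"
proof -
  interpret C: prob_space cantor_measure by (rule prob_space_cantor_measure)
  interpret P: pair_prob_space cantor_measure cantor_measure ..
  obtain N where N: "N \<in> null_sets cantor_measure" "K \<subseteq> N" using assms by (auto simp: null_ideal_iff)
  have "AE p in distr (cantor_measure \<Otimes>\<^sub>M cantor_measure) cantor_measure (\<lambda>p. join (snd p) (fst p)). p \<notin> N"
    unfolding distr_join using N(1) by (rule AE_not_in)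
  then have "AE p in cantor_measure \<Otimes>\<^sub>M cantor_measure. join (snd p) (fst p) \<notin> N"
    by (rule AE_distrD[OF measurable_join])
  then have "AE y in cantor_measure. AE x in cantor_measure. join x y \<notin> N"
    using P.AE_pair by fastforce
  then show ?thesis
  proof (rule AE_mp, intro AE_I2 impI)
    fix y assume "AE x in cantor_measure. join x y \<notin> N"
    then have "{x. join x y \<in> N} \<in> null_ideal" by (intro null_idealI_AE) simp
    then show "{x. join x y \<in> K} \<in> null_ideal" by (rule null_subset) (use N(2) in blast)
  qed
qed

text \<open>
  Cylinders have positive measure, so what holds almost everywhere holds densely.
\<close>
lemma null_section_in_cyl:
  assumes "K \<in> null_ideal"
  shows "\<exists>y\<in>cyl v n. {x. join x y \<in> K} \<in> null_ideal"
proof (rule ccontr)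
  assume "\<not> ?thesis"
  then have "cyl v n \<subseteq> {y. {x. join x y \<in> K} \<notin> null_ideal}" by blast
  moreover have "{y. {x. join x y \<in> K} \<notin> null_ideal} \<in> null_ideal"
    using null_sections[OF assms] by (intro null_idealI_AE) simp
  ultimately have "cyl v n \<in> null_ideal" by (rule null_subset[rotated])
  then have "cyl v n \<in> null_sets cantor_measure"
    using null_sets_completion_iff[OF open_measurable[OF open_cyl]] by (simp add: null_ideal_def)
  then show False using emeasure_cyl[of v n] by (auto simp: null_sets_def)
qed

section \<open>A comeager null set\<close>

text \<open>
  Runs of ones on intervals of length \<open>n\<close> have probability \<open>2\<^sup>-\<^sup>n\<close>, so almost surely only finitely
  many of them occur, while a generic sequence has infinitely many.
\<close>
definition runs :: "cantor set" where
  "runs = {x. \<forall>m. \<exists>n\<ge>m. \<forall>i\<in>{n..<2 * n}. x i}"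

lemma zero_not_in_runs: "zero2 \<notin> runs"
proof
  assume "zero2 \<in> runs"
  then obtain n where n: "n \<ge> 1" "\<forall>i\<in>{n..<2 * n}. zero2 i" unfolding runs_def by blast
  from n(1) have "n \<in> {n..<2 * n}" by simp
  with n(2) show False by blast
qed

lemma null_runs: "runs \<in> null_ideal"
proof -
  have "{x. \<forall>m. \<exists>n\<ge>m. x \<in> {x :: cantor. \<forall>i\<in>{n..<2 * n}. x i = True}} \<in> null_ideal"
  proof (rule limsup_null)
    fix n
    show "{x :: cantor. \<forall>i\<in>{n..<2 * n}. x i = True} \<in> sets cantor_measure"
      using open_coords[of "{n..<2 * n}" "\<lambda>_. True"] by (intro open_measurable) simp
    show "emeasure cantor_measure {x. \<forall>i\<in>{n..<2 * n}. x i = True} \<le> ennreal ((1/2) ^ n)"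
      by (subst emeasure_coords) auto
  qed
  then show ?thesis by (simp add: runs_def)
qed

lemma meager_compl_runs: "- runs \<in> meager_ideal"
proof -
  have "nowhere_dense {x :: cantor. \<forall>n\<ge>m. \<not> (\<forall>i\<in>{n..<2 * n}. x i)}" for m
    unfolding nowhere_dense_cyl
  proof (intro allI)
    fix x :: cantor and l
    define n where "n = max l m"
    define y where "y = (\<lambda>i. if i < n then x i else True)"
    have "y \<in> cyl x l" by (auto simp: cyl_def y_def n_def)
    moreover have "cyl y (2 * n) \<inter> {x. \<forall>n\<ge>m. \<not> (\<forall>i\<in>{n..<2 * n}. x i)} = {}"
    proof -
      have "\<forall>i\<in>{n..<2 * n}. z i" if "z \<in> cyl y (2 * n)" for z
        using that by (simp add: cyl_def y_def)
      moreover have "n \<ge> m" by (simp add: n_def)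
      ultimately show ?thesis by blast
    qed
    ultimately show "\<exists>y k. y \<in> cyl x l \<and> cyl y k \<inter> {x. \<forall>n\<ge>m. \<not> (\<forall>i\<in>{n..<2 * n}. x i)} = {}" by blast
  qed
  then have "(\<Union>m. {x :: cantor. \<forall>n\<ge>m. \<not> (\<forall>i\<in>{n..<2 * n}. x i)}) \<in> meager_ideal"
    by (intro meager_UN nowhere_dense_imp_meager) auto
  moreover have "(\<Union>m. {x :: cantor. \<forall>n\<ge>m. \<not> (\<forall>i\<in>{n..<2 * n}. x i)}) = - runs"
    unfolding runs_def by blast
  ultimately show ?thesis by simp
qed

section \<open>Null sets coded by points\<close>

text \<open>
  An enumeration of all clopen sets: \<open>k\<close> encodes a length and a finite list of admissible prefixes
  of that length.
\<close>
definition block :: "nat \<Rightarrow> cantor set" where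
  "block k = (case from_nat k :: nat \<times> bool list list of (n, L) \<Rightarrow> {x. map x [0..<n] \<in> set L})"

lemma open_block: "open (block k)"
proof -
  obtain n L where k: "(from_nat k :: nat \<times> bool list list) = (n, L)" by fastforce
  have "cyl x n \<subseteq> block k" if "x \<in> block k" for x
  proof
    fix y assume "y \<in> cyl x n"
    then have "map y [0..<n] = map x [0..<n]" by (simp add: cyl_def)
    with that show "y \<in> block k" unfolding block_def k by (simp del: map_eq_conv)
  qed
  then show ?thesis unfolding open_iff_cyl by blast
qed

text \<open>
  A closed set is the decreasing intersection of the clopen sets of all points that agree with one
  of its members on the first \<open>n\<close> coordinates. Continuity of the measure from above makes these small.
\<close>
lemma closed_null_subset_block:
  assumes "closed K" "K \<in> null_ideal" "e > 0"
  shows "\<exists>k. K \<subseteq> block k \<and> emeasure cantor_measure (block k) < e"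
proof -
  interpret C: prob_space cantor_measure by (rule prob_space_cantor_measure)
  define B where "B n = {x. \<exists>y\<in>K. map x [0..<n] = map y [0..<n]}" for n
  have B: "\<exists>k. B n = block k" for n
  proof -
    have "finite ((\<lambda>y. map y [0..<n]) ` K)"
      by (rule finite_subset[OF _ finite_lists_length_eq[of "UNIV :: bool set" n]]) auto
    then obtain L where "set L = (\<lambda>y. map y [0..<n]) ` K" using finite_list by blast
    then have "B n = block (to_nat (n, L))" by (auto simp: block_def B_def)
    then show ?thesis by blast
  qed
  have "(\<Inter>n. B n) \<subseteq> K"
  proof (rule ccontr)
    assume "\<not> (\<Inter>n. B n) \<subseteq> K"
    then obtain x where x: "x \<in> (\<Inter>n. B n)" "x \<in> - K" by blast
    then obtain n where n: "cyl x n \<subseteq> - K" using open_contains_cyl[of "- K" x] assms(1) by blast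
    from x(1) obtain y where "y \<in> K" "map x [0..<n] = map y [0..<n]" by (auto simp: B_def)
    then have "y \<in> cyl x n" by (simp add: cyl_def)
    with n \<open>y \<in> K\<close> show False by blast
  qed
  moreover have KB: "K \<subseteq> B n" for n by (auto simp: B_def)
  ultimately have "(\<Inter>n. B n) = K" by blast
  moreover have "(\<lambda>n. emeasure cantor_measure (B n)) \<longlonglongrightarrow> emeasure cantor_measure (\<Inter>n. B n)"
  proof (rule Lim_emeasure_decseq)
    show "range B \<subseteq> sets cantor_measure"
      using B open_block by (auto intro!: open_measurable) metis
    show "decseq B" unfolding decseq_def B_def by auto
  qed (simp add: C.emeasure_eq_measure)
  moreover have "emeasure cantor_measure K = 0"
  proof -
    have "K \<in> sets cantor_measure" using open_measurable[of "- K"] assms(1) sets.compl_sets[of "- K" cantor_measure] by auto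
    then show ?thesis using assms(2) null_sets_completion_iff[of K cantor_measure] by (simp add: null_ideal_def null_sets_def)
  qed
  ultimately have "(\<lambda>n. emeasure cantor_measure (B n)) \<longlonglongrightarrow> 0" by simp
  then have "eventually (\<lambda>n. emeasure cantor_measure (B n) < e) sequentially"
    using assms(3) by (rule order_tendstoD)
  then obtain n where "emeasure cantor_measure (B n) < e" by (auto simp: eventually_sequentially)
  then show ?thesis using KB[of n] B[of n] by metis
qed

text \<open>
  The code \<open>z\<close> is read in unary: the number of ones from position \<open>n\<close> up to the next zero is the
  index of a clopen set, which counts only if its measure is small enough for stage \<open>n\<close>. No zero or
  a large measure gives the empty set. Any initial segment of \<open>z\<close> of length at most \<open>n\<close> can thus
  be continued so as to capture a prescribed clopen set of small measure at stage \<open>n\<close>.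
\<close>
definition capture :: "nat \<Rightarrow> cantor \<Rightarrow> cantor set" where
  "capture n z = \<Union>{block k |k. (\<forall>i<k. z (n + i)) \<and> \<not> z (n + k) \<and>
     emeasure cantor_measure (block k) \<le> ennreal ((1/2) ^ n)}"

definition trap :: "cantor \<Rightarrow> cantor set" where
  "trap z = {x. \<forall>m. \<exists>n\<ge>m. x \<in> capture n z}"

lemma null_trap: "trap z \<in> null_ideal"
  unfolding trap_def
proof (rule limsup_null)
  fix n
  have "capture n z = {} \<or> (\<exists>k. capture n z = block k \<and> emeasure cantor_measure (block k) \<le> ennreal ((1/2) ^ n))"
  proof (cases "capture n z = {}")
    case False
    then obtain k where k: "\<forall>i<k. z (n + i)" "\<not> z (n + k)" "emeasure cantor_measure (block k) \<le> ennreal ((1/2) ^ n)"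
      unfolding capture_def by blast
    have "j = k" if "\<forall>i<j. z (n + i)" "\<not> z (n + j)" for j
      using that k(1,2) by (metis linorder_neqE_nat)
    then have "capture n z = block k" using k unfolding capture_def by blast
    with k(3) show ?thesis by blast
  qed simp
  then show "capture n z \<in> sets cantor_measure" "emeasure cantor_measure (capture n z) \<le> ennreal ((1/2) ^ n)"
    using open_measurable[OF open_block] by auto
qed

text \<open>
  The point \<open>w\<close> stands for a pair: its even half selects a section of \<open>K\<close> and its odd half is
  the code of a trap. If the section is covered at infinitely many stages, it is trapped. Covering
  at a late stage can be enforced by extending any finite part of \<open>w\<close>: first move to a null section,
  which is covered by a small clopen set, and by compactness so are the sections nearby; then
  write the index of that clopen set into the code.
\<close>
lemma meager_untrapped:
  assumes K: "compact K" "K \<in> null_ideal"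
  shows "{w. \<not> {x. join x (ev w) \<in> K} \<subseteq> trap (od w)} \<in> meager_ideal"
proof -
  have cl: "closed K" using K(1) by (rule compact_imp_closed_cantor)
  have nd: "nowhere_dense {w. \<forall>n\<ge>m. \<not> {x. join x (ev w) \<in> K} \<subseteq> capture n (od w)}" (is "nowhere_dense (?B m)") for m
    unfolding nowhere_dense_cyl
  proof (intro allI)
    fix w l
    define n where "n = max l m"
    obtain y where y: "y \<in> cyl (ev w) l" "{x. join x y \<in> K} \<in> null_ideal"
      using null_section_in_cyl[OF K(2)] by blast
    have "closed {x. join x y \<in> K}"
      using closed_vimage[OF cl continuous_join_left] by (simp add: vimage_def)
    from closed_null_subset_block[OF this y(2), of "ennreal ((1/2) ^ n)"] obtain k where
      k: "{x. join x y \<in> K} \<subseteq> block k" "emeasure cantor_measure (block k) < ennreal ((1/2) ^ n)"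
      by auto
    \<comment> \<open>The odd halves of the points of \<open>K\<close> not covered by the block form a closed set missing \<open>y\<close>.\<close>
    have "compact (K \<inter> ev -` (- block k))"
    proof (rule compact_Int_closed[OF K(1)])
      show "closed (ev -` (- block k))"
        using open_block continuous_ev by (intro closed_vimage) auto
    qed
    then have "compact (od ` (K \<inter> ev -` (- block k)))"
      by (intro compact_continuous_image continuous_on_subset[OF continuous_od]) auto
    then have "open (- od ` (K \<inter> ev -` (- block k)))" by (simp add: compact_imp_closed_cantor open_Compl)
    moreover have "y \<in> - od ` (K \<inter> ev -` (- block k))"
    proof
      assume "y \<in> od ` (K \<inter> ev -` (- block k))"
      then obtain p where p: "p \<in> K" "ev p \<notin> block k" "y = od p" by blast
      then have "join (ev p) y \<in> K" by simp
      with k(1) p(2) show False by blast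
    qed
    ultimately obtain m' where m': "cyl y m' \<subseteq> - od ` (K \<inter> ev -` (- block k))"
      using open_contains_cyl by blast
    have tube: "{x. join x y' \<in> K} \<subseteq> block k" if "y' \<in> cyl y m'" for y'
    proof
      fix x assume "x \<in> {x. join x y' \<in> K}"
      then have "join x y' \<in> K" by simp
      moreover have "y' \<notin> od ` (K \<inter> ev -` (- block k))" using m' that by blast
      ultimately show "x \<in> block k" by (metis Compl_iff IntI ev_join image_eqI od_join vimageI)
    qed
    \<comment> \<open>From position \<open>n\<close> on, the code has \<open>k\<close> ones and then a zero, so it captures \<open>block k\<close> at stage \<open>n\<close>.\<close>
    define z where "z i = (if i < n then od w i else i < n + k)" for i
    define L where "L = max m' (n + k + 1)"
    have "join y z \<in> cyl w l"
      using y(1) by (intro join_cyl) (auto simp: cyl_def z_def n_def)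
    moreover have "u \<notin> ?B m" if u: "u \<in> cyl (join y z) (2 * L)" for u
    proof -
      have "ev u \<in> cyl y m'" using ev_cyl[OF u] cyl_mono[of m' L y] by (auto simp: L_def)
      then have "{x. join x (ev u) \<in> K} \<subseteq> block k" by (rule tube)
      also have "block k \<subseteq> capture n (od u)"
      proof -
        have "od u i = z i" if "i < n + k + 1" for i
          using od_cyl[OF u] that by (auto simp: cyl_def L_def)
        then have "\<forall>i<k. od u (n + i)" "\<not> od u (n + k)" by (simp_all add: z_def)
        then show ?thesis using k(2) unfolding capture_def by (blast intro: less_imp_le)
      qed
      finally show ?thesis by (auto simp: n_def intro!: exI[of _ n])
    qed
    ultimately show "\<exists>y k. y \<in> cyl w l \<and> cyl y k \<inter> ?B m = {}" by blast
  qed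
  have "(\<Union>m. ?B m) \<in> meager_ideal" using nd by (intro meager_UN nowhere_dense_imp_meager) auto
  moreover have "{w. \<not> {x. join x (ev w) \<in> K} \<subseteq> trap (od w)} \<subseteq> (\<Union>m. ?B m)"
    unfolding trap_def by auto
  ultimately show ?thesis by (rule meager_subset)
qed

lemma meager_untrapped_family:
  assumes "countable \<C>" "\<forall>K\<in>\<C>. compact K \<and> K \<in> null_ideal"
  shows "{w. \<not> {x. join x (ev w) \<in> \<Union>\<C>} \<subseteq> trap (od w)} \<in> meager_ideal"
proof -
  have "(\<Union>K\<in>\<C>. {w. \<not> {x. join x (ev w) \<in> K} \<subseteq> trap (od w)}) \<in> meager_ideal"
    using assms meager_untrapped by (intro meager_UN) auto
  then show ?thesis by (rule meager_subset) blast
qed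

section \<open>Cardinal invariants\<close>

lemma union_less_cov:
  assumes cov: "ideal_cov I =o |R|" and I: "\<Union>I = UNIV" and F: "\<F> \<subseteq> I" "|\<F>| <o |R|"
  shows "\<Union>\<F> \<noteq> UNIV"
proof
  assume "\<Union>\<F> = UNIV"
  moreover have "{\<A>. \<A> \<subseteq> I \<and> \<Union>\<A> = UNIV} \<noteq> {}" using I by blast
  ultimately have "ideal_cov I \<le>o |\<F>|"
    using min_card_attained[of "{\<A>. \<A> \<subseteq> I \<and> \<Union>\<A> = UNIV}"] F(1) unfolding ideal_cov_def by auto
  then have "ideal_cov I <o |R|" using F(2) by (rule ordLeq_ordLess_trans)
  with cov show False using not_ordLess_ordIso by blast
qed

lemma ideal_cof_attained:
  obtains \<A> where "\<A> \<subseteq> I" "\<forall>B\<in>I. \<exists>A\<in>\<A>. B \<subseteq> A" "ideal_cof I = |\<A>|"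
proof -
  have "I \<in> {\<A>. \<A> \<subseteq> I \<and> (\<forall>B\<in>I. \<exists>A\<in>\<A>. B \<subseteq> A)}" by blast
  then have "{\<A>. \<A> \<subseteq> I \<and> (\<forall>B\<in>I. \<exists>A\<in>\<A>. B \<subseteq> A)} \<noteq> {}" by blast
  from min_card_attained[OF this] obtain \<A> where
    "\<A> \<subseteq> I" "\<forall>B\<in>I. \<exists>A\<in>\<A>. B \<subseteq> A" "ideal_cof I = |\<A>|"
    unfolding ideal_cof_def by blast
  then show ?thesis by (rule that)
qed

lemma ideal_non_attained:
  assumes "UNIV \<notin> I"
  obtains A where "A \<notin> I" "ideal_non I = |A|"
proof -
  have "{A. A \<notin> I} \<noteq> {}" using assms by blast
  from min_card_attained[OF this] obtain A where "A \<notin> I" "ideal_non I = |A|"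
    unfolding ideal_non_def by blast
  then show ?thesis by (rule that)
qed

text \<open>
  A finite union of null sets is null, so it is not the whole space.
\<close>
lemma infinite_of_cov_null:
  assumes cov: "ideal_cov null_ideal =o |R|"
  shows "infinite R"
proof
  assume R: "finite R"
  have "{\<A>. \<A> \<subseteq> null_ideal \<and> \<Union>\<A> = UNIV} \<noteq> {}" using Union_null_ideal by blast
  from min_card_attained[OF this] obtain \<A> where \<A>: "\<A> \<subseteq> null_ideal" "\<Union>\<A> = UNIV" "ideal_cov null_ideal = |\<A>|"
    unfolding ideal_cov_def by blast
  then have "finite \<A>" using cov R card_of_ordIso_finite by metis
  then have "\<Union>\<A> \<in> null_ideal" using \<A>(1) by (intro countable_Union_null) (auto intro: countable_finite)
  with \<A>(2) UNIV_not_null show False by simp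
qed

lemma card_of_insert_image_less:
  assumes "infinite R" "|S| <o |R|"
  shows "|insert A (f ` S)| <o |R|"
proof -
  have "|f ` S| <o |R|" using card_of_image assms(2) by (rule ordLeq_ordLess_trans)
  moreover have "|{A}| <o |R|" using assms(1) by (intro finite_ordLess_infinite2) auto
  ultimately have "|{A} \<union> f ` S| <o |R|" using assms(1) by (intro card_of_Un_ordLess_infinite)
  then show ?thesis by simp
qed

text \<open>
  Fewer than \<open>cov(N)\<close> null sets do not cover the space. The function \<open>f\<close> makes it possible to
  translate by one half of each element of \<open>S\<close>.
\<close>
lemma avoid_translates_null:
  assumes cov: "ideal_cov null_ideal =o |R|" and S: "|S| <o |R|" and "A \<in> null_ideal" "B \<in> null_ideal"
  shows "\<exists>x. x \<notin> B \<and> (\<forall>h\<in>S. f h \<oplus>\<^sub>2 x \<notin> A)"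
proof -
  let ?\<F> = "insert B ((\<lambda>h. (\<lambda>x. f h \<oplus>\<^sub>2 x) -` A) ` S)"
  have "\<Union>?\<F> \<noteq> UNIV"
  proof (rule union_less_cov[OF cov Union_null_ideal])
    show "?\<F> \<subseteq> null_ideal" using assms(3,4) null_vimage_xor by blast
    show "|?\<F>| <o |R|" by (rule card_of_insert_image_less[OF infinite_of_cov_null[OF cov] S])
  qed
  then show ?thesis by blast
qed

section \<open>Subgroups by transfinite choice\<close>

text \<open>
  The sum in the group of the family \<open>x\<close> over a finite index set \<open>F\<close>: modulo two, a coordinate of the
  sum is the parity of the number of ones.
\<close>
definition xor_sum :: "('r \<Rightarrow> cantor) \<Rightarrow> 'r set \<Rightarrow> cantor" where
  "xor_sum x F = (\<lambda>n. odd (card {r\<in>F. x r n}))"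

lemma xor_sum_insert:
  assumes "finite F" "r \<notin> F"
  shows "xor_sum x (insert r F) = xor_sum x F \<oplus>\<^sub>2 x r"
proof
  fix n
  have "{q \<in> insert r F. x q n} = (if x r n then insert r {q \<in> F. x q n} else {q \<in> F. x q n})"
    by auto
  then show "xor_sum x (insert r F) n = (xor_sum x F n \<noteq> x r n)"
    using assms by (simp add: xor_sum_def)
qed

lemma xor_sum_empty [simp]: "xor_sum x {} = zero2"
  by (simp add: xor_sum_def)

lemma xor_sum_sym_diff:
  assumes "finite A" "finite B"
  shows "xor_sum x (A - B \<union> (B - A)) = xor_sum x A \<oplus>\<^sub>2 xor_sum x B"
proof
  fix n
  let ?c = "\<lambda>F. {r \<in> F. x r n}"
  have un: "?c (A - B \<union> (B - A)) = ?c (A - B) \<union> ?c (B - A)"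
    "?c A = ?c (A - B) \<union> ?c (A \<inter> B)" "?c B = ?c (B - A) \<union> ?c (A \<inter> B)" by auto
  have "card (?c (A - B \<union> (B - A))) = card (?c (A - B)) + card (?c (B - A))"
    unfolding un(1) using assms by (intro card_Un_disjoint) auto
  moreover have "card (?c A) = card (?c (A - B)) + card (?c (A \<inter> B))"
    unfolding un(2) using assms by (intro card_Un_disjoint) auto
  moreover have "card (?c B) = card (?c (B - A)) + card (?c (A \<inter> B))"
    unfolding un(3) using assms by (intro card_Un_disjoint) auto
  ultimately show "xor_sum x (A - B \<union> (B - A)) n = (xor_sum x A n \<noteq> xor_sum x B n)"
    unfolding xor_sum_def by simp argo
qed

lemma subgroup_xor_sums: "subgroup (xor_sum x ` Fpow R) cantor_group"
proof -
  interpret comm_group cantor_group by (rule comm_group_cantor_group)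
  show ?thesis
  proof (rule subgroupI)
    show "xor_sum x ` Fpow R \<subseteq> carrier cantor_group" by (simp add: cantor_group_def)
    show "xor_sum x ` Fpow R \<noteq> {}" using Fpow_not_empty by blast
  next
    fix a assume a: "a \<in> xor_sum x ` Fpow R"
    have "inv\<^bsub>cantor_group\<^esub> a = a"
      by (intro inv_equality cantor_group_square) (auto simp: cantor_group_def)
    with a show "inv\<^bsub>cantor_group\<^esub> a \<in> xor_sum x ` Fpow R" by simp
  next
    fix a b assume "a \<in> xor_sum x ` Fpow R" "b \<in> xor_sum x ` Fpow R"
    then obtain A B where AB: "A \<in> Fpow R" "B \<in> Fpow R" "a = xor_sum x A" "b = xor_sum x B" by blast
    then have "a \<otimes>\<^bsub>cantor_group\<^esub> b = xor_sum x (A - B \<union> (B - A))"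
      by (simp add: cantor_group_def xor_sum_sym_diff Fpow_def)
    moreover have "A - B \<union> (B - A) \<in> Fpow R" using AB by (auto simp: Fpow_def)
    ultimately show "a \<otimes>\<^bsub>cantor_group\<^esub> b \<in> xor_sum x ` Fpow R" by simp
  qed
qed

lemma card_of_Fpow_less:
  assumes "infinite R" "|A| <o |R|"
  shows "|Fpow A| <o |R|"
proof (cases "finite A")
  case True
  then have "finite (Fpow A)" by (simp add: Fpow_def)
  then show ?thesis using assms(1) by (rule finite_ordLess_infinite2)
next
  case False
  then have "|Fpow A| =o |A| " by (rule card_of_Fpow_infinite)
  then show ?thesis using assms(2) by (rule ordIso_ordLess_trans)
qed

text \<open>
  The point for \<open>r\<close> is chosen so that its translates by sums of earlier points avoid \<open>G\<close>; the
  earlier points have fewer than \<open>|R|\<close> finite sums because \<open>|R|\<close> is an infinite cardinal. A nonempty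
  finite sum of chosen points avoids \<open>G\<close> because its last summand was chosen with regard to the sum
  of the others.
\<close>
lemma transfinite_subgroup:
  fixes R :: "'r set" and G :: "cantor set"
  assumes R: "infinite R" and G: "zero2 \<notin> G"
    and step: "\<And>r S. r \<in> R \<Longrightarrow> |S| <o |R| \<Longrightarrow> \<exists>x. Q r x \<and> (\<forall>h\<in>S. h \<oplus>\<^sub>2 x \<notin> G)"
  shows "\<exists>H. subgroup H cantor_group \<and> H \<inter> G = {} \<and> (\<forall>r\<in>R. \<exists>x\<in>H. Q r x)"
proof -
  let ?o = "|R|"
  interpret wo_rel ?o by unfold_locales (rule card_of_Well_order)
  define good where "good x r z \<longleftrightarrow> Q r z \<and> (\<forall>h\<in>xor_sum x ` Fpow (underS r). h \<oplus>\<^sub>2 z \<notin> G)"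
    for x r z
  define x where "x = worec (\<lambda>x r. SOME z. good x r z)"
  have adm: "adm_wo (\<lambda>x r. SOME z. good x r z)"
    unfolding adm_wo_def
  proof (intro allI impI)
    fix f g :: "'r \<Rightarrow> cantor" and r
    assume "\<forall>y\<in>underS r. f y = g y"
    then have "{q \<in> F. f q n} = {q \<in> F. g q n}" if "F \<in> Fpow (underS r)" for F n
      using that by (auto simp: Fpow_def)
    then have "xor_sum f F = xor_sum g F" if "F \<in> Fpow (underS r)" for F
      using that by (simp add: xor_sum_def)
    then have "xor_sum f ` Fpow (underS r) = xor_sum g ` Fpow (underS r)" by (rule image_cong[OF refl])
    then show "(SOME z. good f r z) = (SOME z. good g r z)" by (simp add: good_def)
  qed
  have good: "good x r (x r)" if "r \<in> R" for r
  proof -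
    have "|underS r| <o |R|"
      using that by (intro card_of_underS card_of_Card_order) (simp add: Field_card_of)
    then have "|Fpow (underS r)| <o |R|" by (rule card_of_Fpow_less[OF R])
    then have "|xor_sum x ` Fpow (underS r)| <o |R|" by (rule ordLeq_ordLess_trans[OF card_of_image])
    then have "\<exists>z. good x r z" unfolding good_def using step[OF that] by blast
    moreover have "x r = (SOME z. good x r z)"
      unfolding x_def using worec_fixpoint[OF adm] by metis
    ultimately show ?thesis by (metis someI_ex)
  qed
  have notG: "xor_sum x F \<notin> G" if "F \<in> Fpow R" for F
  proof (cases "F = {}")
    case False
    have F: "finite F" "F \<subseteq> R" using that by (auto simp: Fpow_def)
    \<comment> \<open>The index chosen last among the finitely many in the sum.\<close>
    have "\<exists>r\<in>F. \<forall>q\<in>F. (q, r) \<in> ?o"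
      using F(1) False F(2)
    proof (induction rule: finite_ne_induct)
      case (singleton r)
      then show ?case using REFL by (auto simp: refl_on_def Field_card_of)
    next
      case (insert r F)
      then obtain s where s: "s \<in> F" "\<forall>q\<in>F. (q, s) \<in> ?o" by blast
      have "r \<in> R" "s \<in> R" using insert.prems s(1) by auto
      then have "(r, s) \<in> ?o \<or> (s, r) \<in> ?o \<and> (r, r) \<in> ?o"
        using TOTALS REFL by (auto simp: Field_card_of refl_on_def)
      then show ?case using s TRANS by (auto dest: transD)
    qed
    then obtain r where r: "r \<in> F" "\<forall>q\<in>F. (q, r) \<in> ?o" by blast
    have "F - {r} \<in> Fpow (underS r)" using F(1) r(2) by (auto simp: Fpow_def underS_def)
    then have "xor_sum x (F - {r}) \<oplus>\<^sub>2 x r \<notin> G" using good[of r] r(1) F(2) by (auto simp: good_def)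
    moreover have "xor_sum x F = xor_sum x (F - {r}) \<oplus>\<^sub>2 x r"
      using xor_sum_insert[of "F - {r}" r x] F(1) r(1) by (simp add: insert_absorb)
    ultimately show ?thesis by simp
  qed (simp add: G)
  have mem: "x r \<in> xor_sum x ` Fpow R" if "r \<in> R" for r
  proof -
    have "x r = xor_sum x {r}" using xor_sum_insert[of "{}" r x] by simp
    moreover have "{r} \<in> Fpow R" using that by (simp add: Fpow_def)
    ultimately show ?thesis by blast
  qed
  show ?thesis
  proof (intro exI conjI ballI)
    show "subgroup (xor_sum x ` Fpow R) cantor_group" by (rule subgroup_xor_sums)
    show "xor_sum x ` Fpow R \<inter> G = {}" using notG by blast
    fix r assume "r \<in> R"
    then show "\<exists>z\<in>xor_sum x ` Fpow R. Q r z"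
      using good by (intro bexI[OF _ mem]) (simp_all add: good_def)
  qed
qed

section \<open>The three subgroups\<close>

lemma subgroup_meager_not_null:
  assumes "ideal_cof null_ideal =o ideal_cov null_ideal"
  shows "\<exists>H. subgroup H cantor_group \<and> H \<in> meager_ideal - null_ideal"
proof -
  obtain R where R: "R \<subseteq> null_ideal" "\<forall>B\<in>null_ideal. \<exists>A\<in>R. B \<subseteq> A" "ideal_cof null_ideal = |R|"
    by (rule ideal_cof_attained)
  have cov: "ideal_cov null_ideal =o |R|" using ordIso_symmetric[OF assms] unfolding R(3) .
  have "\<exists>H. subgroup H cantor_group \<and> H \<inter> runs = {} \<and> (\<forall>A\<in>R. \<exists>x\<in>H. x \<notin> A)"
  proof (rule transfinite_subgroup[OF infinite_of_cov_null[OF cov] zero_not_in_runs])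
    fix A and S :: "cantor set"
    assume "A \<in> R" "|S| <o |R|"
    then show "\<exists>x. x \<notin> A \<and> (\<forall>h\<in>S. h \<oplus>\<^sub>2 x \<notin> runs)"
      using R(1) by (intro avoid_translates_null[OF cov _ null_runs, of S A "\<lambda>h. h"]) auto
  qed
  then obtain H where H: "subgroup H cantor_group" "H \<inter> runs = {}" "\<forall>A\<in>R. \<exists>x\<in>H. x \<notin> A" by blast
  have "H \<in> meager_ideal" using H(2) by (intro meager_subset[OF meager_compl_runs]) blast
  moreover have "H \<notin> null_ideal"
  proof
    assume "H \<in> null_ideal"
    then obtain A where "A \<in> R" "H \<subseteq> A" using R(2) by blast
    then show False using H(3) by blast
  qed
  ultimately show ?thesis using H(1) by blast
qed

text \<open>
  Only a nonmeager set \<open>R\<close> is at hand, and the codes of traps are the odd halves of its points. A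
  set covered by compact null sets is lifted along \<open>ev\<close>, which makes all its sections equal to the
  original set; the exceptional points for the lifted compact sets form a meager set, hence do
  not exhaust \<open>R\<close>.
\<close>
lemma subgroup_meager_not_compact_null:
  assumes "ideal_non (meager_ideal :: cantor set set) =o ideal_cov null_ideal"
  shows "\<exists>H. subgroup H cantor_group \<and> H \<in> meager_ideal - compact_null_ideal"
proof -
  obtain R :: "cantor set" where R: "R \<notin> meager_ideal" "ideal_non (meager_ideal :: cantor set set) = |R|"
    by (rule ideal_non_attained[OF UNIV_not_meager])
  have cov: "ideal_cov null_ideal =o |R|" using ordIso_symmetric[OF assms] unfolding R(2) .
  have "\<exists>H. subgroup H cantor_group \<and> H \<inter> runs = {} \<and> (\<forall>w\<in>R. \<exists>x\<in>H. x \<notin> trap (od w))"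
  proof (rule transfinite_subgroup[OF infinite_of_cov_null[OF cov] zero_not_in_runs])
    fix w and S :: "cantor set"
    assume "|S| <o |R|"
    then show "\<exists>x. x \<notin> trap (od w) \<and> (\<forall>h\<in>S. h \<oplus>\<^sub>2 x \<notin> runs)"
      by (rule avoid_translates_null[OF cov _ null_runs null_trap])
  qed
  then obtain H where H: "subgroup H cantor_group" "H \<inter> runs = {}" "\<forall>w\<in>R. \<exists>x\<in>H. x \<notin> trap (od w)" by blast
  have "H \<in> meager_ideal" using H(2) by (intro meager_subset[OF meager_compl_runs]) blast
  moreover have "H \<notin> compact_null_ideal"
  proof
    assume "H \<in> compact_null_ideal"
    then obtain \<C> where \<C>: "countable \<C>" "\<forall>C\<in>\<C>. compact C \<and> C \<in> null_ideal" "H \<subseteq> \<Union>\<C>"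
      unfolding compact_null_ideal_def by blast
    have "compact (ev -` C) \<and> ev -` C \<in> null_ideal" if "C \<in> \<C>" for C
    proof
      have "closed (ev -` C)"
        using \<C>(2) that by (intro closed_vimage[OF _ continuous_ev] compact_imp_closed_cantor) blast
      then show "compact (ev -` C)" using compact_Int_closed[OF compact_UNIV_cantor] by force
      show "ev -` C \<in> null_ideal" using \<C>(2) that by (intro null_vimage_ev) blast
    qed
    then have "{w. \<not> {x. join x (ev w) \<in> \<Union>((-`) ev ` \<C>)} \<subseteq> trap (od w)} \<in> meager_ideal" (is "?B \<in> _")
      using \<C>(1) by (intro meager_untrapped_family) auto
    then have "\<not> R \<subseteq> ?B" using R(1) meager_subset by blast
    then obtain w where w: "w \<in> R" "{x. join x (ev w) \<in> \<Union>((-`) ev ` \<C>)} \<subseteq> trap (od w)" by blast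
    obtain x where x: "x \<in> H" "x \<notin> trap (od w)" using H(3) w(1) by blast
    have "join x (ev w) \<in> \<Union>((-`) ev ` \<C>)" using x(1) \<C>(3) by auto
    with w(2) x(2) show False by blast
  qed
  ultimately show ?thesis using H(1) by blast
qed

text \<open>
  Even halves avoid the comeager null set \<open>runs\<close>, which makes the subgroup meager; odd halves avoid
  \<open>F\<close>, the complement of a null set, which makes it null.
\<close>
lemma subgroup_meager_null_not_compact_null:
  assumes "ideal_cof (meager_ideal :: cantor set set) =o ideal_cov (meager_ideal :: cantor set set)"
    and "ideal_cov (meager_ideal :: cantor set set) =o ideal_cov null_ideal"
  shows "\<exists>H. subgroup H cantor_group \<and> H \<in> (meager_ideal \<inter> null_ideal) - compact_null_ideal"
proof -
  obtain R :: "cantor set set" where R: "R \<subseteq> meager_ideal" "\<forall>B\<in>meager_ideal. \<exists>A\<in>R. B \<subseteq> A"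
      "ideal_cof (meager_ideal :: cantor set set) = |R|"
    by (rule ideal_cof_attained)
  have covM: "ideal_cov (meager_ideal :: cantor set set) =o |R|" using ordIso_symmetric[OF assms(1)] unfolding R(3) .
  have cov: "ideal_cov null_ideal =o |R|"
    using ordIso_transitive[OF ordIso_symmetric[OF assms(2)] covM] .
  note inf = infinite_of_cov_null[OF cov]
  \<comment> \<open>The neutral element is removed as well, since it must not be forbidden; this keeps \<open>F\<close> conull.\<close>
  define F where "F = - insert zero2 runs"
  define G where "G = ev -` runs \<union> od -` F"
  \<comment> \<open>The odd half of \<open>p\<close> is the first component of a pair \<open>w\<close> outside \<open>M\<close> whose code does not trap the even half.\<close>
  define good where "good M p \<longleftrightarrow> (\<exists>w. w \<notin> M \<and> ev w = od p \<and> ev p \<notin> trap (od w))" for M p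
  have F: "F \<in> meager_ideal" unfolding F_def by (rule meager_subset[OF meager_compl_runs]) blast
  have "\<exists>H. subgroup H cantor_group \<and> H \<inter> G = {} \<and> (\<forall>M\<in>R. \<exists>p\<in>H. good M p)"
  proof (rule transfinite_subgroup[OF inf])
    show "zero2 \<notin> G" using zero_not_in_runs by (simp add: G_def F_def ev_def od_def)
  next
    fix M and S :: "cantor set"
    assume M: "M \<in> R" and S: "|S| <o |R|"
    \<comment> \<open>The odd half of the new point and the code of its trap are chosen first: only meager sets have to be avoided.\<close>
    let ?\<F> = "insert M ((\<lambda>h. ev -` ((\<lambda>x. od h \<oplus>\<^sub>2 x) -` F)) ` S)"
    have "\<Union>?\<F> \<noteq> UNIV"
    proof (rule union_less_cov[OF covM Union_meager_ideal])
      show "?\<F> \<subseteq> meager_ideal" using M R(1) F meager_vimage_ev meager_vimage_xor by blast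
      show "|?\<F>| <o |R|" by (rule card_of_insert_image_less[OF inf S])
    qed
    then obtain w where w: "w \<notin> M" "\<forall>h\<in>S. od h \<oplus>\<^sub>2 ev w \<notin> F" by blast
    obtain x where x: "x \<notin> trap (od w)" "\<forall>h\<in>S. ev h \<oplus>\<^sub>2 x \<notin> runs"
      using avoid_translates_null[OF cov S null_runs null_trap, of "od w" ev] by blast
    have "good M (join x (ev w))" unfolding good_def using w(1) x(1) by (intro exI[of _ w]) simp
    moreover have "\<forall>h\<in>S. h \<oplus>\<^sub>2 join x (ev w) \<notin> G" using w(2) x(2)
      by (simp only: G_def Un_iff vimage_eq ev_xor od_xor ev_join od_join) blast
    ultimately show "\<exists>p. good M p \<and> (\<forall>h\<in>S. h \<oplus>\<^sub>2 p \<notin> G)" by blast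
  qed
  then obtain H where H: "subgroup H cantor_group" "H \<inter> G = {}" "\<forall>M\<in>R. \<exists>p\<in>H. good M p" by blast
  have "H \<in> meager_ideal"
    by (rule meager_subset[OF meager_vimage_ev[OF meager_compl_runs]]) (use H(2) in \<open>auto simp: G_def\<close>)
  moreover have "H \<in> null_ideal"
  proof (rule null_subset[OF null_vimage_od])
    have "\<Union>{{zero2}, runs} \<in> null_ideal" using null_singleton null_runs by (intro countable_Union_null) auto
    then show "insert zero2 runs \<in> null_ideal" by simp
    show "H \<subseteq> od -` insert zero2 runs" using H(2) by (auto simp: G_def F_def)
  qed
  moreover have "H \<notin> compact_null_ideal"
  proof
    assume "H \<in> compact_null_ideal"
    then obtain \<C> where \<C>: "countable \<C>" "\<forall>C\<in>\<C>. compact C \<and> C \<in> null_ideal" "H \<subseteq> \<Union>\<C>"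
      unfolding compact_null_ideal_def by blast
    obtain M where M: "M \<in> R" "{w. \<not> {x. join x (ev w) \<in> \<Union>\<C>} \<subseteq> trap (od w)} \<subseteq> M"
      using R(2) meager_untrapped_family[OF \<C>(1,2)] by blast
    obtain p w where p: "p \<in> H" "w \<notin> M" "ev w = od p" "ev p \<notin> trap (od w)"
      using H(3) M(1) unfolding good_def by blast
    have "join (ev p) (ev w) \<in> \<Union>\<C>" using p(1,3) \<C>(3) by auto
    with M(2) p(2,4) show False by blast
  qed
  ultimately show ?thesis using H(1) by blast
qed

theorem corollary7p12:
  shows "(ideal_cof null_ideal =o ideal_cov null_ideal \<longrightarrow>
            (\<exists>H1. subgroup H1 cantor_group \<and> H1 \<in> meager_ideal - null_ideal)) \<and>
         (ideal_non (meager_ideal :: cantor set set) =o ideal_cov null_ideal \<longrightarrow>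
            (\<exists>H2. subgroup H2 cantor_group \<and> H2 \<in> meager_ideal - compact_null_ideal)) \<and>
         (ideal_cof (meager_ideal :: cantor set set) =o ideal_cov (meager_ideal :: cantor set set) \<and>
          ideal_cov (meager_ideal :: cantor set set) =o ideal_cov null_ideal \<longrightarrow>
            (\<exists>H3. subgroup H3 cantor_group \<and> H3 \<in> (meager_ideal \<inter> null_ideal) - compact_null_ideal))"
  using subgroup_meager_not_null subgroup_meager_not_compact_null subgroup_meager_null_not_compact_null
  by blast

end
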